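(* Let $G$ be a graph. (1) If $G\in\mathcal G_{\{\mathcal A_i\}_{i=1}^m}$ for some collection of block partitions $\{\mathcal A_i\}_{i=1}^m$ with $\mathcal A_i=(A_{i,j})_{j=0}^{n_i-1}$, then $\mathcal C=\{C_i\}_{i=1}^m$ with $C_i=G[\{v_{i,j}\}_{j=0}^{n_i-1}]$ forms a chain set induced by a relaxed chronology of standard forces $\mathcal F$ acting on the standard zero forcing set $\{v_{i,0}\}_{i=1}^m$ of $G$. (2) $\operatorname{Z}(G)=\min\{m: G\in\mathcal G_{\{\mathcal A_i\}_{i=1}^m}\text{ for some collection of block partitions }\{\mathcal A_i\}_{i=1}^m\}$ (membership understood up to labeling the vertices of $G$).
   Context: All graphs are finite, simple and undirected; $\mathbb N$ contains $0$. Standard zero forcing: each vertex is blue or white; a blue vertex $u$ with exactly one white neighbor $v$ can force $v$ to become blue ($u\to v$). $B$ is a standard zero forcing set if, starting with exactly $B$ blue, repeated forcing turns all vertices blue; $\operatorname{Z}(G)$ is the minimum size of such a set. $S(G,B)$ is the set of forces valid when exactly $B$ is blue. Relaxed chronology of standard forces for a standard zero forcing set $B$: an ordered family $\mathcal F=\{F^{(k)}\}_{k=1}^K$ of sets of forces ($F^{(k)}=\emptyset$ allowed) such that, with $E^{[0]}=E^{(0)}=B$, $E^{(k)}=\{u: v\to u\in F^{(k)}\text{ for some }v\}$, $E^{[k]}=\bigcup_{j=0}^kE^{(j)}$: (1) $F^{(k)}\subseteq S(G,E^{[k-1]})$ for all $k$; (2) $v_1\to u,v_2\to u\in F^{(k)}$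 implies $v_1=v_2$; (3) $E^{[K]}=V(G)$. Its chain set is the collection of forcing chains $(v_0,\dots,v_\ell)$, one for each $v_0\in B$, with $v_{i-1}\to v_i\in\bigcup_kF^{(k)}$ and $v_\ell$ performing no force; each chain is identified with the induced path on its vertices. A block partition of $\{0,\dots,K\}$ ($K\in\mathbb N$) is a partition $(A_0,\dots,A_{n-1})$ of it into nonempty parts such that $j_1<j_2$ implies every element of $A_{j_1}$ is less than every element of $A_{j_2}$. Family $\mathcal G_{\{\mathcal A_i\}_{i=1}^m}$: given $K$ and block partitions $\mathcal A_i=(A_{i,j})_{j=0}^{n_i-1}$ of $\{0,\dots,K\}$ for $i=1,\dots,m$, let $V=\{v_{i,j}:1\le i\le m,0\le j\le n_i-1\}$, $E_1=\{v_{i,j_1}v_{i,j_2}:|j_1-j_2|=1\}$, $E_2=\{v_{i_1,j_1}v_{i_2,j_2}:i_1\ne i_2,\ A_{i_1,j_1}\cap A_{i_2,j_2}\neq\emptyset\}$. Then $\mathcal G_{\{\mathcal A_i\}_{i=1}^m}$ is the set of all graphs $(V,E_1\cup E)$ with $E\subseteq E_2$. *)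

theory Defs
  imports "Graph_Theory.Graph_Theory" "HOL-Library.Disjoint_Sets"
begin

text \<open>
  A finite simple undirected graph is a \<open>pair_graph\<close>: its arc relation is symmetric and
  irreflexive, and an edge \<open>uw\<close> is represented by the two arcs \<open>(u, w)\<close> and \<open>(w, u)\<close>.
  The graph with no vertices is allowed. A force \<open>u \<rightarrow> w\<close> is the pair \<open>(u, w)\<close>.
\<close>

section \<open>Standard zero forcing\<close>

definition valid_forces :: "'a pair_pre_digraph \<Rightarrow> 'a set \<Rightarrow> ('a \<times> 'a) set" where
  "valid_forces G B = {(u, w). u \<in> B \<and> {x. (u, x) \<in> parcs G \<and> x \<notin> B} = {w}}"

definition force_step :: "'a pair_pre_digraph \<Rightarrow> 'a set rel" where
  "force_step G = {(B, insert w B) | B u w. (u, w) \<in> valid_forces G B}"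

definition zero_forcing_set :: "'a pair_pre_digraph \<Rightarrow> 'a set \<Rightarrow> bool" where
  "zero_forcing_set G B \<longleftrightarrow> B \<subseteq> pverts G \<and> (B, pverts G) \<in> (force_step G)\<^sup>*"

definition zero_forcing_number :: "'a pair_pre_digraph \<Rightarrow> nat" where
  "zero_forcing_number G = (LEAST k. \<exists>B. zero_forcing_set G B \<and> card B = k)"

section \<open>Relaxed chronologies and chain sets\<close>

text \<open>
  A family \<open>F 1, \<dots>, F K\<close> of sets of forces is a function of which only the values at
  \<open>1, \<dots>, K\<close> are used. The set of vertices turned blue at time \<open>k\<close> is \<open>newly_blue B F k\<close>, and
  the set of vertices that are blue after time \<open>k\<close> is \<open>blue B F k\<close>.
\<close>

definition newly_blue :: "'a set \<Rightarrow> (nat \<Rightarrow> ('a \<times> 'a) set) \<Rightarrow> nat \<Rightarrow> 'a set" where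
  "newly_blue B F k = (if k = 0 then B else {u. \<exists>v. (v, u) \<in> F k})"

definition blue :: "'a set \<Rightarrow> (nat \<Rightarrow> ('a \<times> 'a) set) \<Rightarrow> nat \<Rightarrow> 'a set" where
  "blue B F k = (\<Union>j\<in>{0..k}. newly_blue B F j)"

definition relaxed_chronology ::
    "'a pair_pre_digraph \<Rightarrow> 'a set \<Rightarrow> nat \<Rightarrow> (nat \<Rightarrow> ('a \<times> 'a) set) \<Rightarrow> bool" where
  "relaxed_chronology G B K F \<longleftrightarrow>
     zero_forcing_set G B \<and>
     (\<forall>k\<in>{1..K}. F k \<subseteq> valid_forces G (blue B F (k - 1))) \<and>
     (\<forall>k\<in>{1..K}. \<forall>v1 v2 u. (v1, u) \<in> F k \<and> (v2, u) \<in> F k \<longrightarrow> v1 = v2) \<and>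
     blue B F K = pverts G"

definition forcing_chain :: "nat \<Rightarrow> (nat \<Rightarrow> ('a \<times> 'a) set) \<Rightarrow> 'a list \<Rightarrow> bool" where
  "forcing_chain K F c \<longleftrightarrow>
     c \<noteq> [] \<and>
     successively (\<lambda>u w. (u, w) \<in> (\<Union>k\<in>{1..K}. F k)) c \<and>
     (\<nexists>w. (last c, w) \<in> (\<Union>k\<in>{1..K}. F k))"

definition induced_path :: "'a pair_pre_digraph \<Rightarrow> 'a list \<Rightarrow> bool" where
  "induced_path G c \<longleftrightarrow>
     distinct c \<and> set c \<subseteq> pverts G \<and>
     (\<forall>i<length c. \<forall>j<length c. (c ! i, c ! j) \<in> parcs G \<longleftrightarrow> i = Suc j \<or> j = Suc i)"

text \<open>
  In a relaxed chronology the forcing chain from each vertex of \<open>B\<close> is unique and is an induced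
  path, so the clause \<open>induced_path\<close> excludes nothing; it records that replacing a chain by the
  induced subgraph on its vertices amounts to replacing it by a path.
\<close>

definition chain_set ::
    "'a pair_pre_digraph \<Rightarrow> 'a set \<Rightarrow> nat \<Rightarrow> (nat \<Rightarrow> ('a \<times> 'a) set) \<Rightarrow>
     ('a, 'a \<times> 'a) pre_digraph set \<Rightarrow> bool" where
  "chain_set G B K F \<C> \<longleftrightarrow>
     (\<exists>c. (\<forall>v\<in>B. forcing_chain K F (c v) \<and> hd (c v) = v \<and> induced_path G (c v)) \<and>
          \<C> = (\<lambda>v. with_proj G \<restriction> set (c v)) ` B)"

section \<open>Block partitions and the associated graphs\<close>

definition block_partition :: "nat \<Rightarrow> nat set list \<Rightarrow> bool" where
  "block_partition K P \<longleftrightarrow>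
     partition_on {0..K} (set P) \<and>
     (\<forall>j2<length P. \<forall>j1<j2. \<forall>a\<in>P ! j1. \<forall>b\<in>P ! j2. a < b)"

text \<open>
  A collection of \<open>m\<close> block partitions is a function \<open>A\<close> of which only the values at
  \<open>1, \<dots>, m\<close> are used; the block with index \<open>(i, j)\<close> is \<open>A i ! j\<close>, and there are \<open>length (A i)\<close>
  blocks in the \<open>i\<close>-th partition.
\<close>

definition block_indices :: "nat \<Rightarrow> (nat \<Rightarrow> nat set list) \<Rightarrow> (nat \<times> nat) set" where
  "block_indices m A = {(i, j). i \<in> {1..m} \<and> j < length (A i)}"

text \<open>
  The vertices are named by a function \<open>v\<close>, required to be injective on the indices, so that
  graphs of any vertex type can be members.
\<close>

definition labelling :: "nat \<Rightarrow> (nat \<Rightarrow> nat set list) \<Rightarrow> (nat \<Rightarrow> nat \<Rightarrow> 'a) \<Rightarrow> bool" where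
  "labelling m A v \<longleftrightarrow> inj_on (\<lambda>(i, j). v i j) (block_indices m A)"

definition block_vertices :: "nat \<Rightarrow> (nat \<Rightarrow> nat set list) \<Rightarrow> (nat \<Rightarrow> nat \<Rightarrow> 'a) \<Rightarrow> 'a set" where
  "block_vertices m A v = {v i j | i j. (i, j) \<in> block_indices m A}"

definition block_path_edges ::
    "nat \<Rightarrow> (nat \<Rightarrow> nat set list) \<Rightarrow> (nat \<Rightarrow> nat \<Rightarrow> 'a) \<Rightarrow> ('a \<times> 'a) set" where
  "block_path_edges m A v =
     {(v i j1, v i j2) | i j1 j2.
        (i, j1) \<in> block_indices m A \<and> (i, j2) \<in> block_indices m A \<and> \<bar>int j1 - int j2\<bar> = 1}"

definition block_cross_edges ::
    "nat \<Rightarrow> (nat \<Rightarrow> nat set list) \<Rightarrow> (nat \<Rightarrow> nat \<Rightarrow> 'a) \<Rightarrow> ('a \<times> 'a) set" where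
  "block_cross_edges m A v =
     {(v i1 j1, v i2 j2) | i1 j1 i2 j2.
        (i1, j1) \<in> block_indices m A \<and> (i2, j2) \<in> block_indices m A \<and>
        i1 \<noteq> i2 \<and> A i1 ! j1 \<inter> A i2 ! j2 \<noteq> {}}"

text \<open>
  The condition \<open>pair_graph G\<close> makes the set \<open>E\<close> of added arcs symmetric, hence a set of
  undirected edges.
\<close>

definition block_graphs ::
    "nat \<Rightarrow> (nat \<Rightarrow> nat set list) \<Rightarrow> (nat \<Rightarrow> nat \<Rightarrow> 'a) \<Rightarrow> 'a pair_pre_digraph set" where
  "block_graphs m A v =
     {G. pair_graph G \<and> pverts G = block_vertices m A v \<and>
         (\<exists>E \<subseteq> block_cross_edges m A v. parcs G = block_path_edges m A v \<union> E)}"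

end

theory Submission
  imports Defs
begin

text \<open>
  A block partition of \<open>{0..K}\<close> is the same thing as a staircase: a function starting at 0 whose
  steps are 0 or 1, the blocks being its fibres. If \<open>b i\<close> is the staircase of the \<open>i\<close>-th
  partition, read \<open>b i k\<close> as the index of the last blue vertex of the \<open>i\<close>-th chain at time \<open>k\<close>.
  A vertex of index \<open>b i k\<close> may force at time \<open>k + 1\<close> when the \<open>i\<close>-th staircase moves up, because
  all its neighbours on other chains share with it a time at most \<open>k\<close>, hence are blue.
  Conversely, one force at a time from a zero forcing set \<open>B\<close> extends the chains starting in \<open>B\<close>
  and their staircases; two adjacent vertices on different chains share a time, since neither of
  them may force before the other one is blue.
\<close>

section \<open>Staircases\<close>

definition staircase :: "nat \<Rightarrow> (nat \<Rightarrow> nat) \<Rightarrow> bool" where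
  "staircase K b \<longleftrightarrow> b 0 = 0 \<and> (\<forall>k<K. b (Suc k) = b k \<or> b (Suc k) = Suc (b k))"

lemma staircase_mono:
  assumes "staircase K b" "n \<le> K" "k \<le> n"
  shows "b k \<le> b n"
  using assms(3,2)
proof (induction n rule: dec_induct)
  case (step n)
  moreover have "b n \<le> b (Suc n)"
    using assms(1) step.prems unfolding staircase_def by (metis Suc_le_lessD le_SucI order_refl)
  ultimately show ?case by simp
qed simp

text \<open>Discrete intermediate values: rising from 0 to beyond \<open>j\<close> in steps of at
  most 1, the staircase must pass from \<open>j\<close> to \<open>Suc j\<close>. On a chain this is
  the moment when vertex \<open>j\<close> forces the next one.\<close>

lemma staircase_jump:
  assumes "staircase K b" "n \<le> K" "j < b n"
  shows "\<exists>k<n. b k = j \<and> b (Suc k) = Suc j"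
  using assms(2,3)
proof (induction n)
  case 0
  then show ?case using assms(1) by (simp add: staircase_def)
next
  case (Suc n)
  show ?case
  proof (cases "j < b n")
    case True
    then show ?thesis using Suc by (metis Suc_leD less_SucI)
  next
    case False
    then have "b n = j \<and> b (Suc n) = Suc j"
      using Suc assms(1) unfolding staircase_def by (metis Suc_le_lessD less_SucE)
    then show ?thesis by blast
  qed
qed

lemma staircase_onto:
  assumes "staircase K b" "j \<le> b K"
  shows "\<exists>k\<le>K. b k = j"
proof (cases "j = b K")
  case False
  then show ?thesis using staircase_jump[OF assms(1) order_refl, of j] assms(2)
    by (meson le_neq_implies_less less_imp_le)
qed auto

section \<open>Block partitions as staircases\<close>

text \<open>\<open>b k\<close> is the index of the block containing \<open>k\<close>. The order of
  the blocks makes \<open>b\<close> monotone and their nonemptiness makes it onto, and a monotone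
  map of \<open>{0..K}\<close> onto an initial segment of the naturals starts at 0 and skips no
  value.\<close>

lemma block_partition_imp_staircase:
  assumes P: "block_partition K P"
  shows "\<exists>b. staircase K b \<and> length P = Suc (b K) \<and> (\<forall>j<length P. P ! j = {k. k \<le> K \<and> b k = j})"
proof -
  have un: "\<Union>(set P) = {0..K}" and "{} \<notin> set P"
    using P unfolding block_partition_def partition_on_def by blast+
  then have ne: "P ! j \<noteq> {}" if "j < length P" for j using nth_mem[OF that] by metis
  have less: "\<And>j1 j2 a c. j2 < length P \<Longrightarrow> j1 < j2 \<Longrightarrow> a \<in> P ! j1 \<Longrightarrow> c \<in> P ! j2 \<Longrightarrow> a < c"
    using P unfolding block_partition_def by blast
  have "\<forall>k\<in>{0..K}. \<exists>j<length P. k \<in> P ! j"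
  proof
    fix k assume "k \<in> {0..K}"
    then obtain Q where "Q \<in> set P" "k \<in> Q" using un by blast
    then show "\<exists>j<length P. k \<in> P ! j" by (auto simp: in_set_conv_nth)
  qed
  from bchoice[OF this] obtain b where "\<forall>k\<in>{0..K}. b k < length P \<and> k \<in> P ! b k" ..
  then have b: "b k < length P \<and> k \<in> P ! b k" if "k \<le> K" for k using that by simp
  \<comment> \<open>\<open>partition_on\<close> sees only the set of blocks; that no block occurs
    twice in the list comes from the order condition, as a common element would be less than
    itself.\<close>
  have uniq: "j = b k" if "j < length P" "k \<in> P ! j" "k \<le> K" for j k
    using less[of "b k" j k k] less[of j "b k" k k] b[OF that(3)] that(1,2)
    by (cases j "b k" rule: linorder_cases) simp_all
  have inK: "k \<le> K" if "j < length P" "k \<in> P ! j" for j k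
    using UnionI[OF nth_mem[OF that(1)] that(2)] un by simp
  have onto: "\<exists>k\<le>K. b k = j" if j: "j < length P" for j
  proof -
    obtain k where k: "k \<in> P ! j" using ne[OF j] by blast
    show ?thesis using uniq[OF j k] inK[OF j k] by blast
  qed
  have mono: "b k \<le> b k'" if "k \<le> k'" "k' \<le> K" for k k'
    using less[of "b k" "b k'" k' k] b[of k] b[of k'] that by force
  have "P \<noteq> []" using b[of 0] by auto
  then obtain k0 where "k0 \<le> K" "b k0 = 0" using onto[of 0] by auto
  then have b0: "b 0 = 0" using mono[of 0 k0] by simp
  have step: "b (Suc k) = b k \<or> b (Suc k) = Suc (b k)" if k: "k < K" for k
  proof (rule ccontr)
    assume "\<not> ?thesis"
    moreover have "b k \<le> b (Suc k)" using mono k by simp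
    ultimately have lt: "Suc (b k) < b (Suc k)" by simp
    \<comment> \<open>If \<open>Suc (b k)\<close> were skipped, an element \<open>l\<close> of that
      block would lie either up to \<open>k\<close> or from \<open>Suc k\<close> on, and
      monotonicity forbids both.\<close>
    then obtain l where l: "l \<le> K" "b l = Suc (b k)"
      using onto[of "Suc (b k)"] b[of "Suc k"] k by force
    then show False using mono[of l k] mono[of "Suc k" l] lt k by (cases "l \<le> k") auto
  qed
  have "length P = Suc (b K)"
  proof (rule ccontr)
    assume "\<not> ?thesis"
    then have "Suc (b K) < length P" using b[of K] by simp
    then obtain k where "k \<le> K" "b k = Suc (b K)" using onto by blast
    then show False using mono[of k K] by simp
  qed
  moreover have "P ! j = {k. k \<le> K \<and> b k = j}" if "j < length P" for j
    using that uniq inK b by blast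
  ultimately show ?thesis using b0 step unfolding staircase_def by blast
qed

text \<open>Every value up to \<open>b K\<close> is attained, so the fibres are nonempty;
  monotonicity puts them in order.\<close>

lemma staircase_imp_block_partition:
  assumes b: "staircase K b"
  shows "block_partition K (map (\<lambda>j. {k. k \<le> K \<and> b k = j}) [0..<Suc (b K)])"
proof -
  have "partition_on {0..K} ((\<lambda>j. {k. k \<le> K \<and> b k = j}) ` {0..<Suc (b K)})"
    unfolding partition_on_def
  proof (intro conjI)
    show "\<Union>((\<lambda>j. {k. k \<le> K \<and> b k = j}) ` {0..<Suc (b K)}) = {0..K}"
      using staircase_mono[OF b order_refl] by (auto simp: less_Suc_eq_le)
    show "disjoint ((\<lambda>j. {k. k \<le> K \<and> b k = j}) ` {0..<Suc (b K)})"
      by (auto simp: disjoint_def)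
    show "{} \<notin> (\<lambda>j. {k. k \<le> K \<and> b k = j}) ` {0..<Suc (b K)}"
      using staircase_onto[OF b] by (force simp: less_Suc_eq_le)
  qed
  moreover have "a < c" if "a \<le> K" "b a < b c" for a c
    using staircase_mono[OF b that(1), of c] that(2) by (meson leD leI)
  ultimately show ?thesis
    by (auto simp: block_partition_def nth_append simp del: upt_Suc)
qed

section \<open>Chain layouts\<close>

text \<open>
  \<open>X\<close> is the set of vertices labelled so far, so that layouts can be built up force by force.
\<close>

locale chain_layout =
  fixes G :: "'a pair_pre_digraph" and X :: "'a set" and m K :: nat
    and b :: "nat \<Rightarrow> nat \<Rightarrow> nat" and v :: "nat \<Rightarrow> nat \<Rightarrow> 'a"
  assumes stair: "\<And>i. i \<in> {1..m} \<Longrightarrow> staircase K (b i)"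
    and inj: "inj_on (\<lambda>(i, j). v i j) {(i, j). i \<in> {1..m} \<and> j \<le> b i K}"
    and verts: "X = {v i j | i j. i \<in> {1..m} \<and> j \<le> b i K}"
    and path: "\<And>i j1 j2. i \<in> {1..m} \<Longrightarrow> j1 \<le> b i K \<Longrightarrow> j2 \<le> b i K \<Longrightarrow>
      (v i j1, v i j2) \<in> parcs G \<longleftrightarrow> j1 = Suc j2 \<or> j2 = Suc j1"
    and cross: "\<And>i1 i2 j1 j2. i1 \<in> {1..m} \<Longrightarrow> i2 \<in> {1..m} \<Longrightarrow> i1 \<noteq> i2 \<Longrightarrow>
      j1 \<le> b i1 K \<Longrightarrow> j2 \<le> b i2 K \<Longrightarrow> (v i1 j1, v i2 j2) \<in> parcs G \<Longrightarrow>
      \<exists>k\<le>K. b i1 k = j1 \<and> b i2 k = j2"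
begin

lemma label_eq:
  assumes "i \<in> {1..m}" "j \<le> b i K" "i' \<in> {1..m}" "j' \<le> b i' K"
  shows "v i j = v i' j' \<longleftrightarrow> i = i' \<and> j = j'"
  using inj_onD[OF inj, of "(i, j)" "(i', j')"] assms by auto

end

section \<open>Correspondence between block graphs and layouts\<close>

text \<open>Injectivity of the labelling sorts the arcs: within a chain only path arcs can occur,
  between chains only cross arcs, and a common element of two blocks is a common time of two
  staircases. The block counts are recorded to identify the vertex sets of the chains later.\<close>

lemma block_graphs_imp_layout:
  assumes A: "\<forall>i\<in>{1..m}. block_partition K (A i)"
    and lab: "labelling m A v" and G: "G \<in> block_graphs m A v"
  shows "\<exists>b. chain_layout G (pverts G) m K b v \<and> (\<forall>i\<in>{1..m}. length (A i) = Suc (b i K))"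
proof -
  have "\<forall>i\<in>{1..m}. \<exists>b. staircase K b \<and> length (A i) = Suc (b K) \<and>
      (\<forall>j<length (A i). A i ! j = {k. k \<le> K \<and> b k = j})"
    using A block_partition_imp_staircase by blast
  from bchoice[OF this] obtain b where "\<forall>i\<in>{1..m}. staircase K (b i) \<and>
      length (A i) = Suc (b i K) \<and> (\<forall>j<length (A i). A i ! j = {k. k \<le> K \<and> b i k = j})" by blast
  then have b: "\<And>i. i \<in> {1..m} \<Longrightarrow> staircase K (b i)"
      "\<And>i. i \<in> {1..m} \<Longrightarrow> length (A i) = Suc (b i K)"
      "\<And>i j. i \<in> {1..m} \<Longrightarrow> j \<le> b i K \<Longrightarrow> A i ! j = {k. k \<le> K \<and> b i k = j}"
    by (simp_all add: less_Suc_eq_le)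
  obtain E where E: "E \<subseteq> block_cross_edges m A v" "parcs G = block_path_edges m A v \<union> E"
    and V: "pverts G = block_vertices m A v"
    using G by (auto simp: block_graphs_def)
  have idx: "block_indices m A = {(i, j). i \<in> {1..m} \<and> j \<le> b i K}"
    using b(2) by (auto simp: block_indices_def less_Suc_eq_le)
  have inj: "inj_on (\<lambda>(i, j). v i j) {(i, j). i \<in> {1..m} \<and> j \<le> b i K}"
    using lab by (simp add: labelling_def idx)
  have eq: "i = i' \<and> j = j'" if "v i j = v i' j'" "i \<in> {1..m}" "j \<le> b i K" "i' \<in> {1..m}" "j' \<le> b i' K"
    for i i' j j'
    using inj_onD[OF inj, of "(i, j)" "(i', j')"] that by auto
  have "chain_layout G (pverts G) m K b v"
  proof
    show "pverts G = {v i j | i j. i \<in> {1..m} \<and> j \<le> b i K}"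
      by (simp add: V block_vertices_def idx)
    show "(v i j1, v i j2) \<in> parcs G \<longleftrightarrow> j1 = Suc j2 \<or> j2 = Suc j1"
      if i: "i \<in> {1..m}" "j1 \<le> b i K" "j2 \<le> b i K" for i j1 j2
    proof
      assume "(v i j1, v i j2) \<in> parcs G"
      moreover have "(v i j1, v i j2) \<notin> block_cross_edges m A v"
        unfolding block_cross_edges_def idx using eq i by blast
      ultimately have "(v i j1, v i j2) \<in> block_path_edges m A v" using E by blast
      then obtain i' j1' j2' where *: "v i j1 = v i' j1'" "v i j2 = v i' j2'"
          "i' \<in> {1..m}" "j1' \<le> b i' K" "j2' \<le> b i' K" "\<bar>int j1' - int j2'\<bar> = 1"
        unfolding block_path_edges_def idx by blast
      then have "j1 = j1'" "j2 = j2'" using eq i by blast+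
      then show "j1 = Suc j2 \<or> j2 = Suc j1" using *(6) by linarith
    next
      assume "j1 = Suc j2 \<or> j2 = Suc j1"
      then have "\<bar>int j1 - int j2\<bar> = 1" by auto
      then have "(v i j1, v i j2) \<in> block_path_edges m A v"
        unfolding block_path_edges_def idx using i by blast
      then show "(v i j1, v i j2) \<in> parcs G" using E(2) by blast
    qed
    show "\<exists>k\<le>K. b i1 k = j1 \<and> b i2 k = j2"
      if i: "i1 \<in> {1..m}" "i2 \<in> {1..m}" "i1 \<noteq> i2" "j1 \<le> b i1 K" "j2 \<le> b i2 K"
        "(v i1 j1, v i2 j2) \<in> parcs G" for i1 i2 j1 j2
    proof -
      have "(v i1 j1, v i2 j2) \<notin> block_path_edges m A v"
        unfolding block_path_edges_def idx using eq i by blast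
      then have "(v i1 j1, v i2 j2) \<in> block_cross_edges m A v" using E i(6) by blast
      then obtain i1' j1' i2' j2' where *: "v i1 j1 = v i1' j1'" "v i2 j2 = v i2' j2'"
          "i1' \<in> {1..m}" "j1' \<le> b i1' K" "i2' \<in> {1..m}" "j2' \<le> b i2' K" "A i1' ! j1' \<inter> A i2' ! j2' \<noteq> {}"
        unfolding block_cross_edges_def idx by blast
      then have "i1 = i1'" "j1 = j1'" "i2 = i2'" "j2 = j2'" using eq i by blast+
      then show ?thesis using *(7) b(3) i by auto
    qed
  qed (use b(1) inj in auto)
  then show ?thesis using b(2) by blast
qed

lemma layout_imp_block_graphs:
  assumes L: "chain_layout G (pverts G) m K b v" and pg: "pair_graph G"
  defines "A \<equiv> \<lambda>i. map (\<lambda>j. {k. k \<le> K \<and> b i k = j}) [0..<Suc (b i K)]"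
  shows "(\<forall>i\<in>{1..m}. block_partition K (A i)) \<and> labelling m A v \<and> G \<in> block_graphs m A v"
proof -
  interpret chain_layout G "pverts G" m K b v by fact
  interpret pair_graph G by fact
  have len: "length (A i) = Suc (b i K)" for i by (simp add: A_def)
  have nth: "A i ! j = {k. k \<le> K \<and> b i k = j}" if "j \<le> b i K" for i j
    using that unfolding A_def by (simp add: nth_append del: upt_Suc)
  have idx: "block_indices m A = {(i, j). i \<in> {1..m} \<and> j \<le> b i K}"
    by (auto simp: block_indices_def len less_Suc_eq_le)
  have "\<forall>i\<in>{1..m}. block_partition K (A i)"
    unfolding A_def using stair staircase_imp_block_partition by blast
  moreover have "labelling m A v" using inj by (simp add: labelling_def idx)
  moreover have "G \<in> block_graphs m A v"
  proof -
    have "block_path_edges m A v \<subseteq> parcs G"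
    proof
      fix e assume "e \<in> block_path_edges m A v"
      then obtain i j1 j2 where *: "e = (v i j1, v i j2)" "i \<in> {1..m}" "j1 \<le> b i K" "j2 \<le> b i K"
          "\<bar>int j1 - int j2\<bar> = 1"
        unfolding block_path_edges_def idx by blast
      then show "e \<in> parcs G" using path[of i j1 j2] by auto
    qed
    moreover have "e \<in> block_path_edges m A v \<union> block_cross_edges m A v" if e: "e \<in> parcs G" for e
    proof -
      obtain x y where xy: "e = (x, y)" by fastforce
      then have "x \<in> pverts G" "y \<in> pverts G" using e in_arcsD1 in_arcsD2 by auto
      then obtain i1 j1 i2 j2 where *: "x = v i1 j1" "y = v i2 j2" "i1 \<in> {1..m}" "j1 \<le> b i1 K"
          "i2 \<in> {1..m}" "j2 \<le> b i2 K"
        unfolding verts by blast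
      show ?thesis
      proof (cases "i1 = i2")
        case True
        then have "\<bar>int j1 - int j2\<bar> = 1" using path[of i1 j1 j2] * e xy by auto
        then have "e \<in> block_path_edges m A v"
          unfolding block_path_edges_def idx using * xy True by blast
        then show ?thesis ..
      next
        case False
        then have "A i1 ! j1 \<inter> A i2 ! j2 \<noteq> {}"
          using cross[of i1 i2 j1 j2] * e xy nth by auto
        then have "e \<in> block_cross_edges m A v"
          unfolding block_cross_edges_def idx using * xy False by blast
        then show ?thesis ..
      qed
    qed
    ultimately have "\<exists>E \<subseteq> block_cross_edges m A v. parcs G = block_path_edges m A v \<union> E"
      \<comment> \<open>The added edge set consists of all cross arcs present in
        \<open>G\<close>.\<close>
      by (intro exI[of _ "parcs G \<inter> block_cross_edges m A v"]) blast
    moreover have "pverts G = block_vertices m A v"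
      unfolding block_vertices_def idx by (subst verts) simp
    ultimately show ?thesis using pg by (simp add: block_graphs_def)
  qed
  ultimately show ?thesis by blast
qed

section \<open>From layouts to chronologies\<close>

text \<open>Forces valid at the same moment can be performed one by one: a larger blue set keeps a
  force valid as long as its target is still white, and if the target is already blue nothing has to
  be done.\<close>

lemma force_steps_union:
  assumes "finite F" "F \<subseteq> valid_forces G B"
  shows "(B, B \<union> snd ` F) \<in> (force_step G)\<^sup>*"
  using assms
proof (induction F)
  case (insert e F)
  obtain u w where e: "e = (u, w)" by fastforce
  let ?C = "B \<union> snd ` F"
  have *: "(B, ?C) \<in> (force_step G)\<^sup>*" using insert by simp
  show ?case
  proof (cases "w \<in> ?C")
    case True
    then have "B \<union> snd ` insert e F = ?C" using e by auto
    then show ?thesis using * by simp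
  next
    case False
    then have "(u, w) \<in> valid_forces G ?C"
      using insert.prems e by (auto simp: valid_forces_def)
    then have "(?C, insert w ?C) \<in> force_step G" unfolding force_step_def by blast
    moreover have "B \<union> snd ` insert e F = insert w ?C" using e by auto
    ultimately show ?thesis using * by (metis rtrancl.rtrancl_into_rtrancl)
  qed
qed simp

lemma blue_0: "blue B F 0 = B"
  by (simp add: blue_def newly_blue_def)

lemma blue_Suc: "blue B F (Suc k) = blue B F k \<union> snd ` F (Suc k)"
proof -
  have "newly_blue B F (Suc k) = snd ` F (Suc k)" by (force simp: newly_blue_def)
  then show ?thesis by (simp add: blue_def atLeast0_atMost_Suc Un_commute)
qed

text \<open>Expanding every time slot into single forces gives an ordinary forcing sequence, which
  yields the zero forcing property that \<open>relaxed_chronology\<close> includes. Finiteness keeps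
  each expansion finite.\<close>

lemma chronology_force_steps:
  assumes "\<And>k. k \<in> {1..K} \<Longrightarrow> finite (F k) \<and> F k \<subseteq> valid_forces G (blue B F (k - 1))"
  shows "(B, blue B F K) \<in> (force_step G)\<^sup>*"
  using assms
proof (induction K)
  case (Suc K)
  then have "(B, blue B F K) \<in> (force_step G)\<^sup>*" by auto
  moreover have "(blue B F K, blue B F (Suc K)) \<in> (force_step G)\<^sup>*"
    unfolding blue_Suc using Suc.prems[of "Suc K"] by (intro force_steps_union) auto
  ultimately show ?case by (rule rtrancl_trans)
qed (simp add: blue_0)

section \<open>The chronology read off from a layout\<close>

context chain_layout
begin

text \<open>All chains that move up at time \<open>k\<close> force together, which a relaxed
  chronology permits.\<close>

definition forces :: "nat \<Rightarrow> ('a \<times> 'a) set" where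
  "forces k = {(v i (b i (k - 1)), v i (b i k)) | i. i \<in> {1..m} \<and> b i k = Suc (b i (k - 1))}"

definition "starts = {v i 0 | i. i \<in> {1..m}}"

lemma finite_forces: "finite (forces k)"
  unfolding forces_def by simp

text \<open>Each staircase rises by at most 1, so the targets of the forces at one time are exactly
  the vertices by which the initial segments grow. This justifies reading \<open>b i k\<close> as
  the index of the last blue vertex.\<close>

lemma blue_forces:
  assumes "k \<le> K"
  shows "blue starts forces k = {v i j | i j. i \<in> {1..m} \<and> j \<le> b i k}"
  using assms
proof (induction k)
  case 0
  then show ?case using stair by (fastforce simp: blue_0 starts_def staircase_def)
next
  case (Suc k)
  have st: "b i (Suc k) = b i k \<or> b i (Suc k) = Suc (b i k)" if "i \<in> {1..m}" for i
    using stair[OF that] Suc.prems by (simp add: staircase_def)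
  have "snd ` forces (Suc k) = {v i (b i (Suc k)) | i. i \<in> {1..m} \<and> b i (Suc k) = Suc (b i k)}"
    by (force simp: forces_def)
  moreover have "{v i j | i j. i \<in> {1..m} \<and> j \<le> b i (Suc k)} = {v i j | i j. i \<in> {1..m} \<and> j \<le> b i k}
      \<union> {v i (b i (Suc k)) | i. i \<in> {1..m} \<and> b i (Suc k) = Suc (b i k)}"
    using st by (fastforce simp: le_Suc_eq)
  ultimately show ?case using Suc by (simp add: blue_Suc)
qed

lemma le_top:
  assumes "i \<in> {1..m}" "k \<le> K" "j \<le> b i k"
  shows "j \<le> b i K"
  using staircase_mono[OF stair[OF assms(1)] order_refl assms(2)] assms(3) by simp

text \<open>\<open>X = pverts G\<close> matters here: every neighbour of a forcing vertex then has a
  label, so its colour can be read off from the staircases.\<close>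

lemma forces_valid:
  assumes X: "X = pverts G" and pg: "pair_graph G" and k: "k \<in> {1..K}"
  shows "forces k \<subseteq> valid_forces G (blue starts forces (k - 1))"
proof
  interpret pair_graph G by fact
  fix e assume "e \<in> forces k"
  then obtain i where e: "e = (v i (b i (k - 1)), v i (b i k))" and i: "i \<in> {1..m}"
    and up: "b i k = Suc (b i (k - 1))"
    unfolding forces_def by blast
  let ?j = "b i (k - 1)" and ?B = "blue starts forces (k - 1)"
  have k1: "k - 1 \<le> K" "k \<le> K" using k by auto
  have B: "?B = {v i j | i j. i \<in> {1..m} \<and> j \<le> b i (k - 1)}" using blue_forces k1(1) by blast
  have j: "?j \<le> b i K" "Suc ?j \<le> b i K" using le_top[OF i k1(2), of "Suc ?j"] up by auto
  have "x = v i (Suc ?j)" if x: "(v i ?j, x) \<in> parcs G" "x \<notin> ?B" for x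
  proof -
    have "x \<in> pverts G" using x(1) in_arcsD2 by auto
    then obtain i' j' where x': "x = v i' j'" "i' \<in> {1..m}" "j' \<le> b i' K"
      unfolding X[symmetric] verts by blast
    have notle: "\<not> j' \<le> b i' (k - 1)" using x(2) x' B by blast
    show ?thesis
    proof (cases "i' = i")
      case True
      then show ?thesis using path[OF i j(1), of j'] x' x(1) notle by auto
    next
      case False
      then obtain t where t: "t \<le> K" "b i t = ?j" "b i' t = j'"
        using cross[of i i' ?j j'] i x' x(1) j by auto
      \<comment> \<open>From time \<open>k\<close> on the \<open>i\<close>-th staircase is above
        \<open>?j\<close>, so a time at which it equals \<open>?j\<close> is earlier than
        \<open>k\<close>; the neighbour is then blue by time \<open>k - 1\<close>.\<close>
      have "t < k"
        using staircase_mono[OF stair[OF i] t(1), of k] t(2) up by force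
      then have "j' \<le> b i' (k - 1)"
        using staircase_mono[OF stair[OF x'(2)] k1(1), of t] t(3) by simp
      then show ?thesis using notle by blast
    qed
  qed
  moreover have "(v i ?j, v i (Suc ?j)) \<in> parcs G" using path i j by blast
  moreover have "v i (Suc ?j) \<notin> ?B"
  proof
    assume "v i (Suc ?j) \<in> ?B"
    then obtain i' j' where *: "v i (Suc ?j) = v i' j'" "i' \<in> {1..m}" "j' \<le> b i' (k - 1)"
      unfolding B by blast
    then have "i = i' \<and> Suc ?j = j'" using label_eq[OF i j(2)] le_top k1(1) by blast
    then show False using *(3) by auto
  qed
  moreover have "v i ?j \<in> ?B" unfolding B using i by blast
  ultimately have "v i ?j \<in> ?B \<and> {x. (v i ?j, x) \<in> parcs G \<and> x \<notin> ?B} = {v i (Suc ?j)}" by blast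
  then show "e \<in> valid_forces G ?B" by (simp add: e up valid_forces_def)
qed

lemma forces_chronology:
  assumes X: "X = pverts G" and pg: "pair_graph G"
  shows "relaxed_chronology G starts K forces"
proof -
  have blue: "blue starts forces K = pverts G" using blue_forces[of K] verts X by simp
  have "(starts, pverts G) \<in> (force_step G)\<^sup>*"
    using chronology_force_steps[of K forces G starts] finite_forces forces_valid[OF X pg] blue by simp
  moreover have "starts \<subseteq> pverts G"
    unfolding starts_def X[symmetric] verts by blast
  \<comment> \<open>By injectivity the forced vertex determines its chain, and the chain together
    with the time determines the forcing vertex.\<close>
  moreover have "v1 = v2" if k: "k \<in> {1..K}" and f: "(v1, u) \<in> forces k" "(v2, u) \<in> forces k" for k v1 v2 u
  proof -
    obtain i1 i2 where "v1 = v i1 (b i1 (k - 1))" "v2 = v i2 (b i2 (k - 1))"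
        "u = v i1 (b i1 k)" "u = v i2 (b i2 k)"
        "i1 \<in> {1..m}" "i2 \<in> {1..m}"
      using f unfolding forces_def by blast
    moreover from this have "i1 = i2" using label_eq[of i1 "b i1 k" i2 "b i2 k"] le_top[of _ k] k by auto
    ultimately show ?thesis by simp
  qed
  ultimately show ?thesis
    unfolding relaxed_chronology_def zero_forcing_set_def using forces_valid[OF X pg] blue by blast
qed

text \<open>Every index below \<open>b i K\<close> is left by a jump at some time, so once the times
  are forgotten only the successor steps along the chains remain.\<close>

lemma Union_forces:
  "(\<Union>k\<in>{1..K}. forces k) = {(v i j, v i (Suc j)) | i j. i \<in> {1..m} \<and> j < b i K}"
proof (intro equalityI subsetI)
  fix e assume "e \<in> (\<Union>k\<in>{1..K}. forces k)"
  then obtain k i where *: "k \<in> {1..K}" "e = (v i (b i (k - 1)), v i (b i k))" "i \<in> {1..m}"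
      "b i k = Suc (b i (k - 1))"
    unfolding forces_def by blast
  then have "b i (k - 1) < b i K" using le_top[of i k "b i k"] by auto
  then show "e \<in> {(v i j, v i (Suc j)) | i j. i \<in> {1..m} \<and> j < b i K}" using * by auto
next
  fix e assume "e \<in> {(v i j, v i (Suc j)) | i j. i \<in> {1..m} \<and> j < b i K}"
  then obtain i j where e: "e = (v i j, v i (Suc j))" "i \<in> {1..m}" "j < b i K" by blast
  then obtain k where "k < K" "b i k = j" "b i (Suc k) = Suc j"
    using staircase_jump[OF stair] by blast
  then show "e \<in> (\<Union>k\<in>{1..K}. forces k)"
    using e by (intro UN_I[of "Suc k"]) (auto simp: forces_def)
qed

lemma chain:
  assumes i: "i \<in> {1..m}" and X: "X = pverts G"
  defines "c \<equiv> map (v i) [0..<Suc (b i K)]"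
  shows "forcing_chain K forces c \<and> hd c = v i 0 \<and> induced_path G c"
proof -
  have len: "length c = Suc (b i K)" by (simp add: c_def)
  have nth: "c ! j = v i j" if "j \<le> b i K" for j using that unfolding c_def by (simp add: nth_append del: upt_Suc)
  have ne: "c \<noteq> []" using len by auto
  have last: "last c = v i (b i K)" by (simp add: c_def)
  have "hd c = v i 0" using nth[of 0] ne by (simp add: hd_conv_nth)
  moreover have "forcing_chain K forces c"
  proof -
    have "successively (\<lambda>u w. (u, w) \<in> (\<Union>k\<in>{1..K}. forces k)) c"
      unfolding successively_conv_nth len Union_forces using nth i by auto
    moreover have "\<nexists>w. (last c, w) \<in> (\<Union>k\<in>{1..K}. forces k)"
    proof
      assume "\<exists>w. (last c, w) \<in> (\<Union>k\<in>{1..K}. forces k)"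
      \<comment> \<open>A vertex that forces has an index below the top of its chain, whereas
        \<open>last c\<close> is a top.\<close>
      then obtain i' j where *: "v i (b i K) = v i' j" "i' \<in> {1..m}" "j < b i' K"
        unfolding last Union_forces by blast
      then have "i = i'" "b i K = j" using label_eq[OF i order_refl *(2) less_imp_le[OF *(3)]] by blast+
      then show False using *(3) by simp
    qed
    ultimately show ?thesis unfolding forcing_chain_def using ne by blast
  qed
  moreover have "induced_path G c"
    unfolding induced_path_def
  proof (intro conjI allI impI)
    show "distinct c"
      unfolding distinct_conv_nth len using nth label_eq[OF i _ i] by (simp add: less_Suc_eq_le)
    show "set c \<subseteq> pverts G"
      unfolding X[symmetric] verts c_def using i by (fastforce simp: less_Suc_eq_le simp del: upt_Suc)
    show "(c ! p, c ! q) \<in> parcs G \<longleftrightarrow> p = Suc q \<or> q = Suc p" if "p < length c" "q < length c" for p q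
      using path[OF i, of p q] that nth by (simp add: len less_Suc_eq_le)
  qed
  ultimately show ?thesis by blast
qed

lemma forces_chain_set:
  assumes X: "X = pverts G"
  shows "chain_set G starts K forces {with_proj G \<restriction> {v i j | j. j \<le> b i K} | i. i \<in> {1..m}}"
proof -
  \<comment> \<open>\<open>chain_set\<close> indexes chains by starting vertex, the layout by
    number; injectivity makes the number recoverable from the starting vertex.\<close>
  define i0 where "i0 x = (THE i. i \<in> {1..m} \<and> v i 0 = x)" for x
  have i0: "i0 (v i 0) = i" if "i \<in> {1..m}" for i
    unfolding i0_def using that label_eq[of _ 0 i 0] by (intro the_equality) auto
  define c where "c x = map (v (i0 x)) [0..<Suc (b (i0 x) K)]" for x
  have "\<forall>x\<in>starts. forcing_chain K forces (c x) \<and> hd (c x) = x \<and> induced_path G (c x)"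
    using chain[OF _ X] i0 unfolding starts_def c_def by auto
  moreover have "set (c (v i 0)) = {v i j | j. j \<le> b i K}" if "i \<in> {1..m}" for i
    unfolding c_def i0[OF that] by (auto simp: less_Suc_eq_le simp del: upt_Suc)
  then have "{with_proj G \<restriction> {v i j | j. j \<le> b i K} | i. i \<in> {1..m}} = (\<lambda>x. with_proj G \<restriction> set (c x)) ` starts"
    unfolding starts_def Setcompr_eq_image image_image by (intro image_cong) simp_all
  ultimately show ?thesis unfolding chain_set_def by blast
qed

lemma card_starts: "card starts = m"
proof -
  have "inj_on (\<lambda>i. v i 0) {1..m}"
    using label_eq[of _ 0 _ 0] by (auto simp: inj_on_def)
  moreover have "starts = (\<lambda>i. v i 0) ` {1..m}" by (auto simp: starts_def)
  ultimately show ?thesis by (simp add: card_image)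
qed

end

section \<open>From zero forcing sets to layouts\<close>

text \<open>
  The second clause of the conclusion says that a vertex whose chain goes on beyond it has no
  white neighbour; hence the next force starts at the end of a chain.
\<close>

lemma force_steps_imp_layout:
  assumes pg: "pair_graph G" and B: "finite B" "card B = m"
    and steps: "(B, X) \<in> (force_step G)\<^sup>*"
  shows "\<exists>K b v. chain_layout G X m K b v \<and>
    (\<forall>i\<in>{1..m}. \<forall>j<b i K. \<forall>x. (v i j, x) \<in> parcs G \<longrightarrow> x \<in> X)"
  using steps
proof (induction rule: rtrancl_induct)
  case base
  interpret pair_graph G by fact
  obtain f where f: "bij_betw f {1..m} B"
    using B ex_bij_betw_nat_finite_1 by blast
  \<comment> \<open>Before any force, each vertex of \<open>B\<close> is a chain by itself with the
    single time 0. All chains share this time, so any arc between them is allowed.\<close>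
  have "chain_layout G B m 0 (\<lambda>_ _. 0) (\<lambda>i _. f i)"
  proof
    show "inj_on (\<lambda>(i, j). f i) {(i, j). i \<in> {1..m} \<and> j \<le> (0::nat)}"
      using inj_onD[OF bij_betw_imp_inj_on[OF f]] by (intro inj_onI) (clarsimp simp del: atLeastAtMost_iff)
    show "B = {f i | i j. i \<in> {1..m} \<and> j \<le> (0::nat)}"
      unfolding bij_betw_imp_surj_on[OF f, symmetric] by blast
  next
    show "(f i, f i) \<in> parcs G \<longleftrightarrow> j1 = Suc j2 \<or> j2 = Suc j1" if "j1 \<le> 0" "j2 \<le> 0" for i j1 j2
      using that no_loops'[of "f i" "f i"] by auto
  qed (simp_all add: staircase_def)
  moreover have "\<forall>i\<in>{1..m}. \<forall>j<(0::nat). \<forall>x. (f i, x) \<in> parcs G \<longrightarrow> x \<in> B" by simp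
  ultimately show ?case by (intro exI[of _ 0] exI[of _ "\<lambda>_ _. 0"] exI[of _ "\<lambda>i _. f i"] conjI)
next
  case (step X Y)
  interpret pair_graph G by fact
  obtain K b v where L: "chain_layout G X m K b v"
    and "\<forall>i\<in>{1..m}. \<forall>j<b i K. \<forall>x. (v i j, x) \<in> parcs G \<longrightarrow> x \<in> X"
    using step.IH by (elim exE conjE)
  then have inner: "x \<in> X" if "i \<in> {1..m}" "j < b i K" "(v i j, x) \<in> parcs G" for i j x
    using that by simp
  interpret L: chain_layout G X m K b v by fact
  obtain u w where Y: "Y = insert w X" and uw: "(u, w) \<in> valid_forces G X"
    using step.hyps(2) unfolding force_step_def by blast
  then have u: "u \<in> X" and w: "w \<notin> X" "(u, w) \<in> parcs G"
    and only: "\<And>x. (u, x) \<in> parcs G \<Longrightarrow> x \<notin> X \<Longrightarrow> x = w"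
    by (auto simp: valid_forces_def)
  have sym: "(x, y) \<in> parcs G \<longleftrightarrow> (y, x) \<in> parcs G" for x y
    using arcs_symmetric by blast
  have irr: "(x, x) \<notin> parcs G" for x using no_loops' by blast
  \<comment> \<open>By the invariant a vertex with the white neighbour \<open>w\<close> cannot lie
    below the end of its chain, so \<open>u\<close> is the end of some chain
    \<open>p\<close>.\<close>
  obtain p where p: "p \<in> {1..m}" "u = v p (b p K)"
  proof -
    obtain i j where ij: "u = v i j" "i \<in> {1..m}" "j \<le> b i K" using u unfolding L.verts by blast
    then have "\<not> j < b i K" using inner w by blast
    then show ?thesis using that ij by simp
  qed
  \<comment> \<open>One new time \<open>Suc K\<close> is added. Chain \<open>p\<close> grows by
    \<open>w\<close> at that time; all other staircases stay where they are.\<close>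
  define b' where "b' i k = (if k = Suc K then b i K + (if i = p then 1 else 0) else b i k)" for i k
  define v' where "v' i j = (if i = p \<and> j = Suc (b p K) then w else v i j)" for i j
  have b'_old: "b' i k = b i k" if "k \<le> K" for i k using that by (simp add: b'_def)
  have b'_new: "b' i (Suc K) = (if i = p then Suc (b p K) else b i K)" for i by (simp add: b'_def)
  have v'_old: "v' i j = v i j" if "j \<le> b i K" for i j using that by (auto simp: v'_def)
  have v'_new: "v' p (Suc (b p K)) = w" by (simp add: v'_def)
  have split: "j \<le> b' i (Suc K) \<longleftrightarrow> j \<le> b i K \<or> i = p \<and> j = Suc (b p K)" for i j
    by (auto simp: b'_new)
  have inX: "v i j \<in> X" if "i \<in> {1..m}" "j \<le> b i K" for i j using that L.verts by blast
  have w_new: "False" if "v i j = w" "i \<in> {1..m}" "j \<le> b i K" for i j using inX that w by blast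
  \<comment> \<open>Because \<open>w\<close> is still white, the invariant leaves only chain ends as
    its neighbours in \<open>X\<close>. On chain \<open>p\<close> this is \<open>u\<close> alone, so
    the path stays induced.\<close>
  have w_adj: "j = b i K" if "i \<in> {1..m}" "j \<le> b i K" "(v i j, w) \<in> parcs G" for i j
    using inner[of i j w] that w by force
  have "chain_layout G Y m (Suc K) b' v'"
  proof
    show "staircase (Suc K) (b' i)" if "i \<in> {1..m}" for i
      using L.stair[OF that] by (auto simp: staircase_def b'_def less_Suc_eq)
    show "inj_on (\<lambda>(i, j). v' i j) {(i, j). i \<in> {1..m} \<and> j \<le> b' i (Suc K)}"
    proof -
      have "i = i' \<and> j = j'"
        if "v' i j = v' i' j'" "i \<in> {1..m}" "i' \<in> {1..m}" "j \<le> b' i (Suc K)" "j' \<le> b' i' (Suc K)"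
        for i j i' j'
        using that unfolding split using w_new[of i j] w_new[of i' j'] L.label_eq[of i j i' j']
        by (elim disjE conjE) (simp_all add: v'_old v'_new)
      then show ?thesis by (intro inj_onI) fast
    qed
    show "Y = {v' i j | i j. i \<in> {1..m} \<and> j \<le> b' i (Suc K)}"
    proof -
      have "{v' i j | i j. i \<in> {1..m} \<and> j \<le> b' i (Suc K)} = insert w {v i j | i j. i \<in> {1..m} \<and> j \<le> b i K}"
      proof (intro equalityI subsetI)
        fix x assume "x \<in> {v' i j | i j. i \<in> {1..m} \<and> j \<le> b' i (Suc K)}"
        then obtain i j where "x = v' i j" "i \<in> {1..m}" "j \<le> b i K \<or> i = p \<and> j = Suc (b p K)"
          using split by blast
        then show "x \<in> insert w {v i j | i j. i \<in> {1..m} \<and> j \<le> b i K}"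
          using v'_old v'_new by auto
      next
        fix x assume "x \<in> insert w {v i j | i j. i \<in> {1..m} \<and> j \<le> b i K}"
        then consider "x = w" | i j where "x = v i j" "i \<in> {1..m}" "j \<le> b i K" by blast
        then show "x \<in> {v' i j | i j. i \<in> {1..m} \<and> j \<le> b' i (Suc K)}"
        proof cases
          case 1
          then have "x = v' p (Suc (b p K)) \<and> p \<in> {1..m} \<and> Suc (b p K) \<le> b' p (Suc K)"
            using p(1) v'_new split by blast
          then show ?thesis by blast
        next
          case (2 i j)
          then have "x = v' i j \<and> i \<in> {1..m} \<and> j \<le> b' i (Suc K)" using v'_old split by simp
          then show ?thesis by blast
        qed
      qed
      then show ?thesis using Y L.verts by simp
    qed
    show "(v' i j1, v' i j2) \<in> parcs G \<longleftrightarrow> j1 = Suc j2 \<or> j2 = Suc j1"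
      if i: "i \<in> {1..m}" and j: "j1 \<le> b' i (Suc K)" "j2 \<le> b' i (Suc K)" for i j1 j2
    proof -
      have new: "(v p j, w) \<in> parcs G \<longleftrightarrow> j = b p K" if "j \<le> b p K" for j
        using w_adj[OF p(1) that] w(2) p(2) by blast
      consider "j1 \<le> b i K" "j2 \<le> b i K" | "i = p" "j1 \<le> b p K" "j2 = Suc (b p K)"
        | "i = p" "j1 = Suc (b p K)" "j2 \<le> b p K" | "i = p" "j1 = Suc (b p K)" "j2 = Suc (b p K)"
        using j unfolding split by blast
      then show ?thesis
      proof cases
        case 1 then show ?thesis using L.path[OF i] v'_old by simp
      next
        case 2 then show ?thesis using new v'_old v'_new by auto
      next
        case 3 then show ?thesis using new[of j2] v'_old v'_new sym by auto
      next
        case 4 then show ?thesis using irr by simp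
      qed
    qed
    show "\<exists>k\<le>Suc K. b' i1 k = j1 \<and> b' i2 k = j2"
      if i: "i1 \<in> {1..m}" "i2 \<in> {1..m}" "i1 \<noteq> i2" and j: "j1 \<le> b' i1 (Suc K)" "j2 \<le> b' i2 (Suc K)"
        and adj: "(v' i1 j1, v' i2 j2) \<in> parcs G" for i1 i2 j1 j2
    proof -
      consider "j1 \<le> b i1 K" "j2 \<le> b i2 K" | "i2 = p" "j1 \<le> b i1 K" "j2 = Suc (b p K)"
        | "i1 = p" "j1 = Suc (b p K)" "j2 \<le> b i2 K"
        using i(3) j unfolding split by blast
      then show ?thesis
      proof cases
        case 1
        then obtain k where "k \<le> K" "b i1 k = j1" "b i2 k = j2" using L.cross[OF i] v'_old adj by auto
        then show ?thesis using b'_old by (metis le_SucI)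
      next
        case 2
        \<comment> \<open>The shared time is \<open>Suc K\<close>: \<open>w\<close> appears then,
          and chain \<open>i1\<close>, which does not move, still has its end there.\<close>
        then have "j1 = b i1 K" using w_adj[OF i(1)] v'_old v'_new adj by auto
        then show ?thesis using 2 i(3) b'_new by auto
      next
        case 3
        then have "j2 = b i2 K" using w_adj[OF i(2)] v'_old v'_new adj sym by auto
        then show ?thesis using 3 i(3) b'_new by auto
      qed
    qed
  qed
  moreover have "x \<in> Y" if "i \<in> {1..m}" "j < b' i (Suc K)" "(v' i j, x) \<in> parcs G" for i j x
  proof (cases "j < b i K")
    case True
    then show ?thesis using inner that v'_old Y by auto
  next
    case False
    \<comment> \<open>The only vertex that newly becomes inner is \<open>u\<close>, and
      \<open>w\<close> was its only white neighbour.\<close>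
    then have "i = p" "j = b p K" using that(2) by (auto simp: b'_new split: if_splits)
    then show ?thesis using only[of x] that(3) p(2) v'_old Y by auto
  qed
  ultimately show ?case by blast
qed

section \<open>Chain sets and the zero forcing number\<close>

theorem corollary3p12:
  fixes G :: "'a pair_pre_digraph"
  assumes "pair_graph G"
  shows
    "(\<forall>K m (A :: nat \<Rightarrow> nat set list) (v :: nat \<Rightarrow> nat \<Rightarrow> 'a).
        (\<forall>i\<in>{1..m}. block_partition K (A i)) \<and> labelling m A v \<and> G \<in> block_graphs m A v \<longrightarrow>
        zero_forcing_set G {v i 0 | i. i \<in> {1..m}} \<and>
        (\<exists>K' F. relaxed_chronology G {v i 0 | i. i \<in> {1..m}} K' F \<and>
           chain_set G {v i 0 | i. i \<in> {1..m}} K' F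
             {with_proj G \<restriction> {v i j | j. j < length (A i)} | i. i \<in> {1..m}}))
     \<and>
     (let represented = (\<lambda>m. \<exists>K (A :: nat \<Rightarrow> nat set list) (v :: nat \<Rightarrow> nat \<Rightarrow> 'a).
        (\<forall>i\<in>{1..m}. block_partition K (A i)) \<and> labelling m A v \<and> G \<in> block_graphs m A v)
      in (\<exists>m. represented m) \<and> zero_forcing_number G = (LEAST m. represented m))"
proof (intro conjI)
  interpret pair_graph G by fact
  \<comment> \<open>The cardinality is included because the second part also draws on this
    fact.\<close>
  have chronology: "zero_forcing_set G {v i 0 | i. i \<in> {1..m}} \<and> card {v i 0 | i. i \<in> {1..m}} = m \<and>
      (\<exists>K' F. relaxed_chronology G {v i 0 | i. i \<in> {1..m}} K' F \<and>
         chain_set G {v i 0 | i. i \<in> {1..m}} K' F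
           {with_proj G \<restriction> {v i j | j. j < length (A i)} | i. i \<in> {1..m}})"
    if hyp: "\<forall>i\<in>{1..m}. block_partition K (A i)" "labelling m A v" "G \<in> block_graphs m A v"
    for K m A and v :: "nat \<Rightarrow> nat \<Rightarrow> 'a"
  proof -
    obtain b where "chain_layout G (pverts G) m K b v" and len: "\<forall>i\<in>{1..m}. length (A i) = Suc (b i K)"
      using block_graphs_imp_layout[OF hyp] by blast
    then interpret L: chain_layout G "pverts G" m K b v by simp
    have "{with_proj G \<restriction> {v i j | j. j < length (A i)} | i. i \<in> {1..m}} =
        {with_proj G \<restriction> {v i j | j. j \<le> b i K} | i. i \<in> {1..m}}"
      unfolding Setcompr_eq_image using len by (intro image_cong) (simp_all add: less_Suc_eq_le)
    then have chains: "chain_set G {v i 0 | i. i \<in> {1..m}} K L.forces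
        {with_proj G \<restriction> {v i j | j. j < length (A i)} | i. i \<in> {1..m}}"
      using L.forces_chain_set[OF refl] unfolding L.starts_def by simp
    have chron: "relaxed_chronology G {v i 0 | i. i \<in> {1..m}} K L.forces"
      using L.forces_chronology[OF refl assms] unfolding L.starts_def .
    show ?thesis
      using chains chron L.card_starts unfolding L.starts_def relaxed_chronology_def by blast
  qed
  then show "\<forall>K m (A :: nat \<Rightarrow> nat set list) (v :: nat \<Rightarrow> nat \<Rightarrow> 'a).
        (\<forall>i\<in>{1..m}. block_partition K (A i)) \<and> labelling m A v \<and> G \<in> block_graphs m A v \<longrightarrow>
        zero_forcing_set G {v i 0 | i. i \<in> {1..m}} \<and>
        (\<exists>K' F. relaxed_chronology G {v i 0 | i. i \<in> {1..m}} K' F \<and>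
           chain_set G {v i 0 | i. i \<in> {1..m}} K' F
             {with_proj G \<restriction> {v i j | j. j < length (A i)} | i. i \<in> {1..m}})"
    by blast
  define represented where "represented = (\<lambda>m. \<exists>K (A :: nat \<Rightarrow> nat set list) (v :: nat \<Rightarrow> nat \<Rightarrow> 'a).
        (\<forall>i\<in>{1..m}. block_partition K (A i)) \<and> labelling m A v \<and> G \<in> block_graphs m A v)"
  \<comment> \<open>This is more than equality of minima: the sizes of zero forcing sets are exactly
    the represented numbers, so the two \<open>LEAST\<close> terms agree.\<close>
  have iff: "(\<exists>B. zero_forcing_set G B \<and> card B = m) \<longleftrightarrow> represented m" for m
  proof
    assume "\<exists>B. zero_forcing_set G B \<and> card B = m"
    then obtain B where B: "finite B" "card B = m" "(B, pverts G) \<in> (force_step G)\<^sup>*"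
      unfolding zero_forcing_set_def using finite_subset finite_verts by blast
    then obtain K b v where "chain_layout G (pverts G) m K b v"
      using force_steps_imp_layout[OF assms] by blast
    from layout_imp_block_graphs[OF this assms] show "represented m"
      unfolding represented_def by (intro exI)
  next
    assume "represented m"
    then show "\<exists>B. zero_forcing_set G B \<and> card B = m"
      unfolding represented_def using chronology by blast
  qed
  \<comment> \<open>The whole vertex set is zero forcing with no force at all, so some
    \<open>m\<close> is represented and \<open>LEAST\<close> is a genuine minimum.\<close>
  have "zero_forcing_set G (pverts G)" by (simp add: zero_forcing_set_def)
  then have "\<exists>m. represented m" using iff by blast
  then show "let represented = (\<lambda>m. \<exists>K (A :: nat \<Rightarrow> nat set list) (v :: nat \<Rightarrow> nat \<Rightarrow> 'a).
        (\<forall>i\<in>{1..m}. block_partition K (A i)) \<and> labelling m A v \<and> G \<in> block_graphs m A v)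
      in (\<exists>m. represented m) \<and> zero_forcing_number G = (LEAST m. represented m)"
    unfolding represented_def[symmetric] Let_def zero_forcing_number_def iff by blast
qed

end
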